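(* (ZFC) There exists a Hausdorff $P$-space of cardinality $\mathfrak{c}=2^{\aleph_0}$ which is not weakly Whyburn, and there exists a Hausdorff weak $P$-space of cardinality $\omega_1$ which is not weakly Whyburn.
   Context: A $P$-space is a topological space in which every $G_\delta$ set is open. A weak $P$-space is a topological space in which every countable set is closed. A set $F\subseteq X$ is an almost closed set converging to $x\in X$, written $F\to x$, if $\overline{F}\setminus F=\{x\}$. A space $X$ is weakly Whyburn if for each non-closed set $A\subseteq X$ there are a point $x\in\overline{A}\setminus A$ and a set $F\subseteq A$ with $F\to x$. *)

theory Defs
  imports "HOL-Analysis.Analysis"
begin

unbundle cardinal_syntax

definition P_space :: "'a topology \<Rightarrow> bool" where
  "P_space X \<longleftrightarrow> (\<forall>S. gdelta_in X S \<longrightarrow> openin X S)"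

definition weak_P_space :: "'a topology \<Rightarrow> bool" where
  "weak_P_space X \<longleftrightarrow> (\<forall>S. S \<subseteq> topspace X \<and> countable S \<longrightarrow> closedin X S)"

definition almost_closed_converges :: "'a topology \<Rightarrow> 'a set \<Rightarrow> 'a \<Rightarrow> bool" where
  "almost_closed_converges X F x \<longleftrightarrow>
     F \<subseteq> topspace X \<and> (X closure_of F) - F = {x}"

definition weakly_Whyburn :: "'a topology \<Rightarrow> bool" where
  "weakly_Whyburn X \<longleftrightarrow>
     (\<forall>A. A \<subseteq> topspace X \<and> \<not> closedin X A \<longrightarrow>
        (\<exists>x F. x \<in> (X closure_of A) - A \<and> F \<subseteq> A \<and> almost_closed_converges X F x))"

(* HOL cannot quantify existentially over types, so a space of cardinality omega1 or continuum is
   given on a subset of the type "nat set". This loses nothing: both cardinals are at most that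
   of the type, so every such space is homeomorphic to one whose points are sets of naturals. *)
abbreviation omega1 :: "nat set rel" where
  "omega1 \<equiv> cardSuc natLeq"

abbreviation continuum :: "(nat \<Rightarrow> bool) rel" where
  "continuum \<equiv> ctwo ^c natLeq"

end

theory Submission
  imports Defs "HOL-Library.Countable_Set_Type"
begin

text \<open>Both spaces consist of sequences over an uncountable set, a neighbourhood of a finite
  sequence \<open>s\<close> containing almost all successors of each of its finite members.

  For the P-space, \<open>almost all\<close> means all but countably many, and the infinite branches are added as
  isolated points. If all successors of \<open>s\<close> have neighbourhoods missing a set \<open>F\<close> of branches, these
  glue to a neighbourhood of \<open>s\<close> missing \<open>F\<close>. So \<open>s\<close> is never the only limit of \<open>F\<close>.

  For the weak P-space there are too many branches; only the finite sequences over \<open>\<omega>\<^sub>1\<close> are kept.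
  The sequences of even length form a dense set \<open>A\<close> with crowded complement, and by Zorn's lemma the
  topology may be taken maximal with this property. If \<open>F \<subseteq> A\<close> had a single limit outside \<open>F\<close>, the
  complement of \<open>F\<close> could be declared open without destroying the property. Refining the topology
  preserves both being Hausdorff and being a weak P-space.\<close>

section \<open>Topologies from bases and transport along injections\<close>

text \<open>Openness is a neighbourhood condition, so openness and closure unfold to statements
  about members of \<open>\<B>\<close>. Closure of \<open>\<B>\<close> under binary intersection
  makes this a topology.\<close>

definition base_topology :: "'a set set \<Rightarrow> 'a topology" where
  "base_topology \<B> = topology (\<lambda>U. \<forall>x\<in>U. \<exists>B\<in>\<B>. x \<in> B \<and> B \<subseteq> U)"

lemma openin_base_topology:
  assumes "\<forall>B\<in>\<B>. \<forall>C\<in>\<B>. B \<inter> C \<in> \<B>"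
  shows "openin (base_topology \<B>) U \<longleftrightarrow> (\<forall>x\<in>U. \<exists>B\<in>\<B>. x \<in> B \<and> B \<subseteq> U)"
proof -
  have "istopology (\<lambda>U. \<forall>x\<in>U. \<exists>B\<in>\<B>. x \<in> B \<and> B \<subseteq> U)"
    unfolding istopology_def
  proof (intro conjI allI impI ballI)
    fix S T x
    assume S: "\<forall>x\<in>S. \<exists>B\<in>\<B>. x \<in> B \<and> B \<subseteq> S" and T: "\<forall>x\<in>T. \<exists>B\<in>\<B>. x \<in> B \<and> B \<subseteq> T"
      and x: "x \<in> S \<inter> T"
    obtain B C where "B \<in> \<B>" "x \<in> B" "B \<subseteq> S" "C \<in> \<B>" "x \<in> C" "C \<subseteq> T"
      using S T x by blast
    then show "\<exists>B\<in>\<B>. x \<in> B \<and> B \<subseteq> S \<inter> T"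
      by (intro bexI[of _ "B \<inter> C"]) (use assms in auto)
  next
    fix \<K> x assume "\<forall>K\<in>\<K>. \<forall>x\<in>K. \<exists>B\<in>\<B>. x \<in> B \<and> B \<subseteq> K" "x \<in> \<Union>\<K>"
    then show "\<exists>B\<in>\<B>. x \<in> B \<and> B \<subseteq> \<Union>\<K>"
      by (meson Sup_upper UnionE subset_trans)
  qed
  then show ?thesis
    by (simp add: base_topology_def)
qed

lemma openin_base_topology_base:
  assumes "\<forall>B\<in>\<B>. \<forall>C\<in>\<B>. B \<inter> C \<in> \<B>" "B \<in> \<B>"
  shows "openin (base_topology \<B>) B"
  unfolding openin_base_topology[OF assms(1)] using assms(2) by blast

lemma topspace_base_topology:
  assumes "\<forall>B\<in>\<B>. \<forall>C\<in>\<B>. B \<inter> C \<in> \<B>"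
  shows "topspace (base_topology \<B>) = \<Union>\<B>"
proof -
  have "openin (base_topology \<B>) (\<Union>\<B>)"
    unfolding openin_base_topology[OF assms] by blast
  moreover have "U \<subseteq> \<Union>\<B>" if "openin (base_topology \<B>) U" for U
    using that unfolding openin_base_topology[OF assms] by blast
  ultimately show ?thesis
    by (metis openin_subset openin_topspace subset_antisym)
qed

lemma in_closure_of_base_topology:
  assumes "\<forall>B\<in>\<B>. \<forall>C\<in>\<B>. B \<inter> C \<in> \<B>"
  shows "x \<in> base_topology \<B> closure_of S \<longleftrightarrow> x \<in> \<Union>\<B> \<and> (\<forall>B\<in>\<B>. x \<in> B \<longrightarrow> B \<inter> S \<noteq> {})"
proof
  assume "x \<in> base_topology \<B> closure_of S"
  then show "x \<in> \<Union>\<B> \<and> (\<forall>B\<in>\<B>. x \<in> B \<longrightarrow> B \<inter> S \<noteq> {})"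
    using openin_base_topology_base[OF assms] unfolding in_closure_of topspace_base_topology[OF assms] by blast
next
  assume x: "x \<in> \<Union>\<B> \<and> (\<forall>B\<in>\<B>. x \<in> B \<longrightarrow> B \<inter> S \<noteq> {})"
  have "\<exists>y\<in>S. y \<in> U" if U: "openin (base_topology \<B>) U" "x \<in> U" for U
  proof -
    obtain B where "B \<in> \<B>" "x \<in> B" "B \<subseteq> U"
      using U unfolding openin_base_topology[OF assms] by blast
    with x show ?thesis
      by blast
  qed
  with x show "x \<in> base_topology \<B> closure_of S"
    unfolding in_closure_of topspace_base_topology[OF assms] by blast
qed

lemma not_weakly_WhyburnI:
  assumes "A \<subseteq> topspace X" "\<not> closedin X A"
    and no_limit: "\<And>F x. F \<subseteq> A \<Longrightarrow> x \<notin> A \<Longrightarrow> X closure_of F - F = {x} \<Longrightarrow> False"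
  shows "\<not> weakly_Whyburn X"
proof
  assume "weakly_Whyburn X"
  then obtain x F where "x \<in> X closure_of A - A" "F \<subseteq> A" "almost_closed_converges X F x"
    using assms(1,2) unfolding weakly_Whyburn_def by metis
  then show False
    by (intro no_limit[of F x]) (auto simp: almost_closed_converges_def)
qed

text \<open>The spaces are built on nodes but have to live on \<open>nat set\<close>. The copy is
  the pullback along the inverse of \<open>e\<close>.\<close>

lemma homeomorphic_copy:
  assumes "inj_on e (topspace X)"
  obtains Y where "topspace Y = e ` topspace X" "homeomorphic_map X Y e"
proof -
  let ?g = "inv_into (topspace X) e"
  define Y where "Y = pullback_topology (e ` topspace X) ?g X"
  have top: "topspace Y = e ` topspace X"
    using assms by (auto simp: Y_def topspace_pullback_topology)
  have "continuous_map Y X ?g"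
    unfolding Y_def using continuous_map_pullback[OF continuous_map_id] by fastforce
  moreover have "continuous_map X Y e"
    unfolding Y_def
  proof (rule continuous_map_pullback')
    show "continuous_map X X (?g \<circ> e)"
      by (rule continuous_map_eq[of _ _ id]) (auto simp: assms)
  qed auto
  ultimately have "homeomorphic_maps X Y e ?g"
    using assms by (auto simp: homeomorphic_maps_def top)
  with top that show thesis
    by (metis homeomorphic_maps_map)
qed

section \<open>Invariance under homeomorphisms\<close>

lemma homeomorphic_map_P_space:
  assumes "homeomorphic_map X Y e" "P_space X"
  shows "P_space Y"
  unfolding P_space_def
proof (intro allI impI)
  fix S assume S: "gdelta_in Y S"
  then obtain T where "T \<subseteq> topspace X" "S = e ` T"
    using homeomorphic_imp_surjective_map[OF assms(1)] gdelta_in_subset[OF S]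
    by (metis subset_imageE)
  then show "openin Y S"
    using S assms homeomorphic_map_gdeltaness homeomorphic_map_openness
    by (metis P_space_def)
qed

lemma homeomorphic_map_weak_P_space:
  assumes "homeomorphic_map X Y e" "weak_P_space X"
  shows "weak_P_space Y"
  unfolding weak_P_space_def
proof (intro allI impI)
  fix S assume S: "S \<subseteq> topspace Y \<and> countable S"
  have inj: "inj_on e (topspace X)" and surj: "e ` topspace X = topspace Y"
    using assms(1) homeomorphic_imp_injective_map homeomorphic_imp_surjective_map by blast+
  obtain T where T: "T \<subseteq> topspace X" "S = e ` T"
    using S surj by (metis subset_imageE)
  then have "countable T"
    using S inj by (metis countable_image_inj_on inj_on_subset)
  then show "closedin Y S"
    using T assms homeomorphic_map_closedness by (metis weak_P_space_def)
qed

text \<open>The direction from the copy back to the original is the one used, contrapositively. A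
  homeomorphism commutes with closure and, being injective, with set difference, so sets with a
  single outer limit correspond.\<close>

lemma homeomorphic_map_weakly_Whyburn:
  assumes e: "homeomorphic_map X Y e" and W: "weakly_Whyburn Y"
  shows "weakly_Whyburn X"
  unfolding weakly_Whyburn_def
proof (intro allI impI)
  fix A assume A: "A \<subseteq> topspace X \<and> \<not> closedin X A"
  have inj: "inj_on e (topspace X)" and surj: "e ` topspace X = topspace Y"
    using e homeomorphic_imp_injective_map homeomorphic_imp_surjective_map by blast+
  have cl: "Y closure_of (e ` G) - e ` G = e ` (X closure_of G - G)" if "G \<subseteq> topspace X" for G
    using homeomorphic_map_closure_of[OF e that] inj_on_image_set_diff[OF inj] that
      closure_of_subset_topspace by (metis Diff_subset subset_trans)
  have "e ` A \<subseteq> topspace Y" "\<not> closedin Y (e ` A)"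
    using A surj homeomorphic_map_closedness[OF e] by auto
  then obtain y F where y: "y \<in> Y closure_of (e ` A) - e ` A" and F: "F \<subseteq> e ` A"
      and Fy: "Y closure_of F - F = {y}"
    using W unfolding weakly_Whyburn_def almost_closed_converges_def by blast
  obtain G where G: "G \<subseteq> A" "F = e ` G"
    using F by (metis subset_imageE)
  obtain x where x: "x \<in> X closure_of A - A" "y = e x"
    using y cl A by blast
  have "e ` (X closure_of G - G) = e ` {x}"
    using Fy cl G A x by (metis image_empty image_insert subset_trans)
  moreover have "X closure_of G - G \<subseteq> topspace X" "{x} \<subseteq> topspace X"
    using closure_of_subset_topspace x by fastforce+
  ultimately have "X closure_of G - G = {x}"
    using inj_on_image_eq_iff[OF inj] by blast
  with x G A show "\<exists>x F. x \<in> X closure_of A - A \<and> F \<subseteq> A \<and> almost_closed_converges X F x"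
    unfolding almost_closed_converges_def by blast
qed

section \<open>Maximal bases\<close>

text \<open>The invariants concern one or two members of a base at a time, so they survive unions of
  chains and Zorn's lemma applies to bases. \<open>crowded\<close> says that the complement of
  \<open>A\<close> has no isolated point.\<close>

lemma maximal_base_not_weakly_Whyburn:
  assumes sub: "\<B>\<^sub>0 \<subseteq> Pow X" and X: "X \<in> \<B>\<^sub>0" and A: "A \<subseteq> X" "A \<noteq> X"
    and int: "\<And>B C. B \<in> \<B>\<^sub>0 \<Longrightarrow> C \<in> \<B>\<^sub>0 \<Longrightarrow> B \<inter> C \<in> \<B>\<^sub>0"
    and dense: "\<And>B. B \<in> \<B>\<^sub>0 \<Longrightarrow> B \<noteq> {} \<Longrightarrow> B \<inter> A \<noteq> {}"
    and crowded: "\<And>B y. B \<in> \<B>\<^sub>0 \<Longrightarrow> B - A \<noteq> {y}"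
  obtains \<B> where "\<B>\<^sub>0 \<subseteq> \<B>" "\<B> \<subseteq> Pow X" "\<forall>B\<in>\<B>. \<forall>C\<in>\<B>. B \<inter> C \<in> \<B>"
    "\<not> weakly_Whyburn (base_topology \<B>)"
proof -
  define \<A> where "\<A> = {\<B>. \<B>\<^sub>0 \<subseteq> \<B> \<and> \<B> \<subseteq> Pow X \<and> (\<forall>B\<in>\<B>. \<forall>C\<in>\<B>. B \<inter> C \<in> \<B>) \<and>
    (\<forall>B\<in>\<B>. B \<noteq> {} \<longrightarrow> B \<inter> A \<noteq> {}) \<and> (\<forall>B\<in>\<B>. \<forall>y. B - A \<noteq> {y})}"
  have \<A>D: "\<B>\<^sub>0 \<subseteq> \<B>" "\<B> \<subseteq> Pow X" "\<forall>B\<in>\<B>. \<forall>C\<in>\<B>. B \<inter> C \<in> \<B>"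
    "\<And>B. B \<in> \<B> \<Longrightarrow> B \<noteq> {} \<Longrightarrow> B \<inter> A \<noteq> {}" "\<And>B y. B \<in> \<B> \<Longrightarrow> B - A \<noteq> {y}" if "\<B> \<in> \<A>" for \<B>
    using that by (simp_all add: \<A>_def)
  have \<A>I: "\<B> \<in> \<A>" if "\<B>\<^sub>0 \<subseteq> \<B>" "\<B> \<subseteq> Pow X" "\<And>B C. B \<in> \<B> \<Longrightarrow> C \<in> \<B> \<Longrightarrow> B \<inter> C \<in> \<B>"
    "\<And>B. B \<in> \<B> \<Longrightarrow> B \<noteq> {} \<Longrightarrow> B \<inter> A \<noteq> {}" "\<And>B y. B \<in> \<B> \<Longrightarrow> B - A \<noteq> {y}" for \<B>
    using that by (simp add: \<A>_def)
  have "\<B>\<^sub>0 \<in> \<A>"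
    using sub int dense crowded by (rule \<A>I[OF order_refl])
  have "\<exists>\<B>\<in>\<A>. \<forall>\<C>\<in>\<A>. \<B> \<subseteq> \<C> \<longrightarrow> \<C> = \<B>"
  proof (rule subset_Zorn_nonempty)
    fix \<K> assume ne: "\<K> \<noteq> {}" and "subset.chain \<A> \<K>"
    then have \<K>: "\<K> \<subseteq> \<A>" and chain: "\<And>\<B> \<C>. \<B> \<in> \<K> \<Longrightarrow> \<C> \<in> \<K> \<Longrightarrow> \<B> \<subseteq> \<C> \<or> \<C> \<subseteq> \<B>"
      by (auto simp: subset_chain_def)
    show "\<Union>\<K> \<in> \<A>"
    proof (rule \<A>I)
      show "\<B>\<^sub>0 \<subseteq> \<Union>\<K>"
        using ne \<K> \<A>D(1) by (meson Sup_upper2 all_not_in_conv subsetD)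
      show "\<Union>\<K> \<subseteq> Pow X"
        using \<K> \<A>D(2) by (meson Sup_least subsetD)
    next
      fix B C assume "B \<in> \<Union>\<K>" "C \<in> \<Union>\<K>"
      then obtain \<B> \<C> where "\<B> \<in> \<K>" "B \<in> \<B>" "\<C> \<in> \<K>" "C \<in> \<C>"
        by (elim UnionE)
      with chain obtain \<D> where \<D>: "\<D> \<in> \<K>" "B \<in> \<D>" "C \<in> \<D>"
        by (metis subsetD)
      then have "B \<inter> C \<in> \<D>"
        using \<A>D(3)[of \<D>] \<K> by (metis subsetD)
      with \<D> show "B \<inter> C \<in> \<Union>\<K>"
        by (metis UnionI)
    next
      fix B assume "B \<in> \<Union>\<K>" "B \<noteq> {}"
      then show "B \<inter> A \<noteq> {}"
        using \<K> \<A>D(4) by (metis UnionE subsetD)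
    next
      fix B y assume "B \<in> \<Union>\<K>"
      then show "B - A \<noteq> {y}"
        using \<K> \<A>D(5) by (metis UnionE subsetD)
    qed
  qed (use \<open>\<B>\<^sub>0 \<in> \<A>\<close> in auto)
  then obtain \<B> where \<B>: "\<B> \<in> \<A>" and max: "\<And>\<C>. \<C> \<in> \<A> \<Longrightarrow> \<B> \<subseteq> \<C> \<Longrightarrow> \<C> = \<B>"
    by metis
  note B0 = \<A>D(1)[OF \<B>] and BX = \<A>D(2)[OF \<B>] and Bint = \<A>D(3)[OF \<B>]
    and Bdense = \<A>D(4)[OF \<B>] and Bcrowded = \<A>D(5)[OF \<B>]
  have UB: "\<Union>\<B> = X"
    using BX B0 X by blast
  let ?T = "base_topology \<B>"
  note cl = in_closure_of_base_topology[OF Bint, unfolded UB]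
  have "?T closure_of A = X"
    using Bdense by (fastforce simp: cl)
  then have nclosed: "\<not> closedin ?T A"
    using A(2) closure_of_closedin by metis
  have "\<not> weakly_Whyburn ?T"
  proof (rule not_weakly_WhyburnI[OF _ nclosed])
    show "A \<subseteq> topspace ?T"
      using A(1) by (simp add: topspace_base_topology[OF Bint] UB)
  next
    fix F y assume F: "F \<subseteq> A" and y: "y \<notin> A" and Fy: "?T closure_of F - F = {y}"
    text \<open>If \<open>B - F\<close> were nonempty and missed the dense set \<open>A\<close>, then \<open>B - A\<close> would lie in the
      closure of \<open>F\<close> and hence be \<open>{y}\<close>. So all the sets \<open>B - F\<close> may be added to the base.\<close>
    have "B - F = {}" if B: "B \<in> \<B>" and BF: "(B - F) \<inter> A = {}" for B
    proof -
      have "w \<in> ?T closure_of F" if "w \<in> B" for w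
        unfolding cl
      proof (intro conjI ballI impI)
        show "w \<in> X"
          using that B BX by blast
        fix C assume "C \<in> \<B>" "w \<in> C"
        \<comment> \<open>\<open>B \<inter> C\<close> is a nonempty basic set, so it meets the dense
          set \<open>A\<close>, and \<open>B \<inter> A \<subseteq> F\<close>.\<close>
        then have "B \<inter> C \<inter> A \<noteq> {}"
          using Bdense Bint B that by blast
        then show "C \<inter> F \<noteq> {}"
          using BF by blast
      qed
      then have "B - A \<subseteq> {y}"
        using Fy F by blast
      then have "B - A = {}"
        using Bcrowded[OF B] by blast
      then show ?thesis
        using BF by blast
    qed
    \<comment> \<open>Removing a part of \<open>A\<close> does not change the trace on the
      complement of \<open>A\<close>, so crowdedness is inherited.\<close>
    moreover have "B - F - A = B - A" for B
      using F by blast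
    ultimately have diff: "B - F = {} \<or> (B - F) \<inter> A \<noteq> {}" "B - F - A = B - A" if "B \<in> \<B>" for B
      using that by metis+
    let ?\<C> = "\<B> \<union> (\<lambda>B. B - F) ` \<B>"
    have "?\<C> \<in> \<A>"
    proof (rule \<A>I)
      fix B C assume "B \<in> ?\<C>" "C \<in> ?\<C>"
      then obtain B' C' where "B' \<in> \<B>" "B = B' \<or> B = B' - F" "C' \<in> \<B>" "C = C' \<or> C = C' - F"
        by (elim UnE imageE) auto
      moreover from this have "B' \<inter> C' \<in> \<B>"
        using Bint by simp
      moreover from calculation have "B \<inter> C = B' \<inter> C' \<or> B \<inter> C = B' \<inter> C' - F"
        by auto
      ultimately show "B \<inter> C \<in> ?\<C>"
        by auto
    next
      fix B assume "B \<in> ?\<C>" "B \<noteq> {}"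
      then show "B \<inter> A \<noteq> {}"
        by (elim UnE imageE) (use Bdense diff(1) in metis)+
    next
      fix B y assume "B \<in> ?\<C>"
      then show "B - A \<noteq> {y}"
        by (elim UnE imageE) (use Bcrowded diff(2) in simp_all)
    qed (use B0 BX in auto)
    \<comment> \<open>Since \<open>X\<close> is basic, maximality makes \<open>X - F\<close> basic
      as well: a neighbourhood of \<open>y\<close> missing \<open>F\<close>.\<close>
    then have "X - F \<in> \<B>"
      using max[of ?\<C>] X B0 by blast
    moreover have "y \<in> ?T closure_of F" "y \<notin> F"
      using Fy by blast+
    ultimately show False
      unfolding cl by blast
  qed
  with that[OF B0 BX Bint] show thesis .
qed

section \<open>The tree of finite and infinite sequences\<close>

type_synonym 'k node = "'k list + (nat \<Rightarrow> 'k)"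

fun trunc :: "nat \<Rightarrow> 'k node \<Rightarrow> 'k list" where
  "trunc n (Inl s) = take n s"
| "trunc n (Inr f) = map f [0..<n]"

text \<open>As \<open>take\<close> does not pad, a list shorter than \<open>t\<close> is never a
  member: the members are exactly the finite and infinite extensions of \<open>t\<close>, including
  \<open>t\<close>.\<close>

definition subtree :: "'k list \<Rightarrow> 'k node set" where
  "subtree t = {p. trunc (length t) p = t}"

text \<open>The second clause makes a good set contain the branches it follows, while still allowing
  \<open>{Inr f}\<close> to be good; without it no neighbourhood of a finite sequence need contain a branch.\<close>

definition good :: "'k set \<Rightarrow> 'k node set \<Rightarrow> bool" where
  "good K V \<longleftrightarrow> (\<forall>s. Inl s \<in> V \<longrightarrow> countable {k \<in> K. Inl (s @ [k]) \<notin> V}) \<and>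
     (\<forall>f. (\<forall>\<^sub>F n in sequentially. Inl (map f [0..<n]) \<in> V) \<longrightarrow> Inr f \<in> V)"

text \<open>A countable union of countable exceptional sets is countable, and the branch clause
  passes to any intersection. This is the source of the P-space property.\<close>

lemma good_Inter:
  assumes "countable \<V>" "\<And>V. V \<in> \<V> \<Longrightarrow> good K V"
  shows "good K (\<Inter>\<V>)"
  unfolding good_def
proof (intro conjI allI impI)
  fix s assume "Inl s \<in> \<Inter>\<V>"
  then have "countable (\<Union>V\<in>\<V>. {k \<in> K. Inl (s @ [k]) \<notin> V})"
    using assms by (intro countable_UN) (auto simp: good_def)
  then show "countable {k \<in> K. Inl (s @ [k]) \<notin> \<Inter>\<V>}"
    by (rule countable_subset[rotated]) auto
next
  fix f assume f: "\<forall>\<^sub>F n in sequentially. Inl (map f [0..<n]) \<in> \<Inter>\<V>"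
  have "Inr f \<in> V" if V: "V \<in> \<V>" for V
  proof -
    have "\<forall>\<^sub>F n in sequentially. Inl (map f [0..<n]) \<in> V"
      using f by (rule eventually_mono) (use V in auto)
    then show ?thesis
      using assms(2)[OF V] by (simp add: good_def)
  qed
  then show "Inr f \<in> \<Inter>\<V>"
    by blast
qed

lemma good_Int: "good K U \<Longrightarrow> good K V \<Longrightarrow> good K (U \<inter> V)"
  using good_Inter[of "{U, V}" K] by auto

lemma good_UNIV: "good K UNIV"
  by (simp add: good_def)

text \<open>From \<open>length t\<close> on, an initial segment has the same truncation as its
  branch. This settles the branch clause of \<open>good\<close> both for a subtree and for its
  complement.\<close>

lemma eventually_in_subtree:
  "\<forall>\<^sub>F n in sequentially. Inl (map f [0..<n]) \<in> subtree t \<longleftrightarrow> Inr f \<in> subtree t"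
  using eventually_ge_at_top[of "length t"]
  by eventually_elim (simp add: subtree_def take_map)

lemma Inr_in_subtree:
  assumes "\<forall>\<^sub>F n in sequentially. Inl (map f [0..<n]) \<in> subtree t"
  shows "Inr f \<in> subtree t"
  using eventually_conj[OF assms eventually_in_subtree[of f t]]
  by (metis (mono_tags, lifting) eventually_sequentially order_refl)

lemma good_subtree: "good K (subtree t)"
  unfolding good_def
proof (intro conjI allI impI Inr_in_subtree)
  fix s assume "Inl s \<in> subtree t"
  then have "length t \<le> length s" "take (length t) s = t"
    by (auto simp: subtree_def min_def dest: arg_cong[of _ _ length] split: if_splits)
  then have "{k \<in> K. Inl (s @ [k]) \<notin> subtree t} = {}"
    by (simp add: subtree_def)
  then show "countable {k \<in> K. Inl (s @ [k]) \<notin> subtree t}"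
    by (metis countable_empty)
qed

text \<open>A step from outside into the subtree must complete \<open>t\<close> exactly, so
  \<open>last t\<close> is the only possible exception. Subtrees are therefore clopen, whence the
  Hausdorff property.\<close>

lemma good_Compl_subtree: "good K (- subtree t)"
  unfolding good_def
proof (intro conjI allI impI)
  fix s assume s: "Inl s \<in> - subtree t"
  have "k = last t" if "Inl (s @ [k]) \<in> subtree t" for k
  proof (cases "length t \<le> length s")
    case True
    with s that show ?thesis
      by (simp add: subtree_def)
  next
    case False
    with that have "s @ [k] = t"
      by (simp add: subtree_def)
    then show ?thesis
      by auto
  qed
  then have "{k \<in> K. Inl (s @ [k]) \<notin> - subtree t} \<subseteq> {last t}"
    by auto
  then show "countable {k \<in> K. Inl (s @ [k]) \<notin> - subtree t}"
    by (rule countable_subset) simp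
next
  fix f assume "\<forall>\<^sub>F n in sequentially. Inl (map f [0..<n]) \<in> - subtree t"
  from eventually_conj[OF this eventually_in_subtree[of f t]] show "Inr f \<in> - subtree t"
    by (metis (mono_tags, lifting) ComplD ComplI eventually_sequentially order_refl)
qed

text \<open>Suitable sequences \<open>t\<close> are the longer of two lists, a segment of a branch
  longer than the given list, or a segment reaching past a disagreement of two branches.\<close>

lemma subtrees_separate:
  assumes "p \<noteq> q"
  obtains t where "(p \<in> subtree t) \<noteq> (q \<in> subtree t)"
proof (cases p; cases q)
  fix s t assume p: "p = Inl s" and q: "q = Inl t"
  show thesis
  proof (cases "length s \<le> length t")
    case True
    then show thesis
      using that[of t] assms p q by (auto simp: subtree_def)
  next
    case False
    then show thesis
      using that[of s] assms p q by (auto simp: subtree_def)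
  qed
next
  fix s f assume p: "p = Inl s" and q: "q = Inr f"
  have "s \<noteq> map f [0..<Suc (length s)]"
    by (metis diff_zero length_map length_upt n_not_Suc_n)
  then show thesis
    using that[of "map f [0..<Suc (length s)]"] p q by (simp add: subtree_def)
next
  fix s f assume p: "p = Inr f" and q: "q = Inl s"
  have "s \<noteq> map f [0..<Suc (length s)]"
    by (metis diff_zero length_map length_upt n_not_Suc_n)
  then show thesis
    using that[of "map f [0..<Suc (length s)]"] p q by (simp add: subtree_def)
next
  fix f g assume p: "p = Inr f" and q: "q = Inr g"
  then obtain m where "f m \<noteq> g m"
    using assms by auto
  then show thesis
    using that[of "map f [0..<Suc m]"] p q by (auto simp: subtree_def)
qed

lemma good_separate:
  assumes "p \<noteq> q"
  obtains U V where "good K U" "good K V" "p \<in> U" "q \<in> V" "U \<inter> V = {}"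
proof -
  obtain t where "(p \<in> subtree t) \<noteq> (q \<in> subtree t)"
    using subtrees_separate[OF assms] .
  then show thesis
    using that[OF good_subtree[of K t] good_Compl_subtree[of K t]]
      that[OF good_Compl_subtree[of K t] good_subtree[of K t]] by blast
qed

lemma good_successor:
  assumes "uncountable K" "good K V" "Inl s \<in> V"
  obtains k where "k \<in> K" "Inl (s @ [k]) \<in> V"
proof -
  have "countable {k \<in> K. Inl (s @ [k]) \<notin> V}"
    using assms by (simp add: good_def)
  then have "K \<noteq> {k \<in> K. Inl (s @ [k]) \<notin> V}"
    using assms(1) by metis
  then show thesis
    using that by blast
qed

section \<open>A P-space of size continuum\<close>

lemma openin_good:
  "openin (base_topology (Collect (good K))) U \<longleftrightarrow> (\<forall>x\<in>U. \<exists>B. good K B \<and> x \<in> B \<and> B \<subseteq> U)"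
  by (subst openin_base_topology) (auto intro: good_Int)

lemma topspace_good: "topspace (base_topology (Collect (good K))) = UNIV"
  by (subst topspace_base_topology) (auto intro: good_Int good_UNIV)

lemma closure_good:
  "x \<in> base_topology (Collect (good K)) closure_of S \<longleftrightarrow> (\<forall>B. good K B \<and> x \<in> B \<longrightarrow> B \<inter> S \<noteq> {})"
  by (subst in_closure_of_base_topology) (auto intro: good_Int good_UNIV)

lemma Hausdorff_good: "Hausdorff_space (base_topology (Collect (good K)))"
  unfolding Hausdorff_space_def
proof (intro allI impI, elim conjE)
  fix x y :: "'a node" assume "x \<noteq> y"
  then obtain U V where "good K U" "good K V" "x \<in> U" "y \<in> V" "U \<inter> V = {}"
    using good_separate by metis
  then show "\<exists>U V. openin (base_topology (Collect (good K))) U \<and>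
      openin (base_topology (Collect (good K))) V \<and> x \<in> U \<and> y \<in> V \<and> disjnt U V"
    unfolding openin_good disjnt_def by blast
qed

lemma P_space_good: "P_space (base_topology (Collect (good K)))"
  unfolding P_space_def
proof (intro allI impI)
  fix S assume "gdelta_in (base_topology (Collect (good K))) S"
  then obtain \<U> where \<U>: "countable \<U>" "\<And>U. U \<in> \<U> \<Longrightarrow> openin (base_topology (Collect (good K))) U"
    and S: "S = \<Inter>\<U>"
    unfolding gdelta_in_alt intersection_of_def by auto
  show "openin (base_topology (Collect (good K))) S"
    unfolding openin_good
  proof
    fix x assume "x \<in> S"
    then have "\<forall>U\<in>\<U>. \<exists>B. good K B \<and> x \<in> B \<and> B \<subseteq> U"
      using \<U>(2) S unfolding openin_good by blast
    then obtain B where B: "\<And>U. U \<in> \<U> \<Longrightarrow> good K (B U) \<and> x \<in> B U \<and> B U \<subseteq> U"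
      by metis
    have "good K (\<Inter>(B ` \<U>))"
      using \<U>(1) B by (intro good_Inter) auto
    then show "\<exists>B. good K B \<and> x \<in> B \<and> B \<subseteq> S"
      using B S by (intro exI[of _ "\<Inter>(B ` \<U>)"]) auto
  qed
qed

text \<open>Passing from \<open>s\<close> to successors inside \<open>V\<close> again and again
  traces a branch, which the branch clause puts into \<open>V\<close>. Hence the branches are not
  closed.\<close>

lemma good_meets_branches:
  assumes "uncountable K" "good K V" "Inl s \<in> V"
  shows "\<exists>f. Inr f \<in> V"
proof -
  \<comment> \<open>If no successor lies in \<open>V\<close> the choice is arbitrary, but the length
    still grows by one.\<close>
  define nxt where "nxt u = u @ [SOME k. Inl (u @ [k]) \<in> V]" for u
  have nxt: "Inl (nxt u) \<in> V" if "Inl u \<in> V" for u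
    unfolding nxt_def by (rule someI_ex) (use good_successor[OF assms(1,2) that] in blast)
  define u where "u n = (nxt ^^ n) s" for n
  have uSuc: "u (Suc n) = nxt (u n)" for n
    by (simp add: u_def)
  have uV: "Inl (u n) \<in> V" for n
    by (induction n) (use assms nxt in \<open>auto simp: u_def\<close>)
  have len: "length (u n) = length s + n" for n
    by (induction n) (auto simp: u_def nxt_def)
  have ext: "take (length (u n)) (u (n + m)) = u n" for n m
  proof (induction m)
    case (Suc m)
    have "length (u n) \<le> length (u (n + m))"
      by (simp add: len)
    with Suc show ?case
      by (simp add: uSuc nxt_def)
  qed simp
  \<comment> \<open>\<open>u (Suc i)\<close> is longer than \<open>i\<close>, so the entry exists;
    by \<open>ext\<close> later stages keep it.\<close>
  define f where "f i = u (Suc i) ! i" for i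
  have "map f [0..<length (u n)] = u n" for n
  proof (rule nth_equalityI)
    fix i assume "i < length (map f [0..<length (u n)])"
    then have i: "i < length (u n)"
      by simp
    have "u (Suc i) ! i = u n ! i"
    proof (cases "Suc i \<le> n")
      case True
      then show ?thesis
        using ext[of "Suc i" "n - Suc i"] len[of "Suc i"] nth_take[of i "length (u (Suc i))" "u n"]
        by simp
    next
      case False
      then show ?thesis
        using ext[of n "Suc i - n"] i nth_take[of i "length (u n)" "u (Suc i)"] by simp
    qed
    then show "map f [0..<length (u n)] ! i = u n ! i"
      using i by (simp add: f_def)
  qed simp
  then have "Inl (map f [0..<length s + n]) \<in> V" for n
    using uV len by metis
  then have "\<forall>\<^sub>F n in sequentially. Inl (map f [0..<n]) \<in> V"
    unfolding eventually_sequentially by (metis le_Suc_ex)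
  then show ?thesis
    using assms(2) by (auto simp: good_def)
qed

text \<open>Gluing of neighbourhoods of all successors of \<open>s\<close>. Cutting them down to
  disjoint subtrees ensures that a branch eventually in the union stays in a single piece, whose
  branch clause then applies.\<close>

lemma good_step:
  assumes V: "\<And>k. k \<in> K \<Longrightarrow> good K (V k)" "\<And>k. k \<in> K \<Longrightarrow> Inl (s @ [k]) \<in> V k"
  shows "good K (insert (Inl s) (\<Union>k\<in>K. V k \<inter> subtree (s @ [k])))" (is "good K ?W")
  unfolding good_def
proof (intro conjI allI impI)
  have mem: "Inl (s @ [k]) \<in> ?W" if "k \<in> K" for k
    using V(2)[OF that] that by (auto simp: subtree_def)
  fix t assume "Inl t \<in> ?W"
  then consider "t = s" | k where "k \<in> K" "Inl t \<in> V k \<inter> subtree (s @ [k])"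
    by auto
  then show "countable {k \<in> K. Inl (t @ [k]) \<notin> ?W}"
  proof cases
    case 1
    then show ?thesis
      using mem by (metis (mono_tags, lifting) Collect_empty_eq countable_empty)
  next
    case 2
    have "countable {j \<in> K. Inl (t @ [j]) \<notin> V k \<inter> subtree (s @ [k])}"
      using good_Int[OF V(1)[OF 2(1)] good_subtree] 2(2) unfolding good_def by blast
    then show ?thesis
      by (rule countable_subset[rotated]) (use 2 in auto)
  qed
next
  fix f assume f: "\<forall>\<^sub>F n in sequentially. Inl (map f [0..<n]) \<in> ?W"
  \<comment> \<open>Segments longer than \<open>s\<close> differ from \<open>s\<close>, and their
    entry at position \<open>length s\<close> names the piece containing them, the same one for all
    \<open>n\<close>.\<close>
  let ?k = "f (length s)"
  have "\<forall>\<^sub>F n in sequentially. ?k \<in> K \<and> Inl (map f [0..<n]) \<in> V ?k \<inter> subtree (s @ [?k])"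
    using f eventually_gt_at_top[of "length s"]
  proof eventually_elim
    case (elim n)
    then have "map f [0..<n] \<noteq> s"
      by (metis diff_zero length_map length_upt less_irrefl)
    with elim obtain k where k: "k \<in> K" "Inl (map f [0..<n]) \<in> V k \<inter> subtree (s @ [k])"
      by auto
    then have "take (Suc (length s)) (map f [0..<n]) = s @ [k]"
      by (simp add: subtree_def)
    then have "(s @ [k]) ! length s = map f [0..<n] ! length s"
      by (metis lessI nth_take)
    then have "k = ?k"
      using elim by simp
    with k show ?case
      by simp
  qed
  then have k: "?k \<in> K" and "\<forall>\<^sub>F n in sequentially. Inl (map f [0..<n]) \<in> V ?k \<inter> subtree (s @ [?k])"
    by (auto simp: eventually_conj_iff)
  then have "Inr f \<in> V ?k \<inter> subtree (s @ [?k])"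
    using good_Int[OF V(1)[OF k] good_subtree] unfolding good_def by blast
  with k show "Inr f \<in> ?W"
    by blast
qed

lemma not_weakly_Whyburn_good:
  assumes K: "uncountable K"
  shows "\<not> weakly_Whyburn (base_topology (Collect (good K)))" (is "\<not> weakly_Whyburn ?T")
proof (rule not_weakly_WhyburnI)
  show "range Inr \<subseteq> topspace ?T"
    by (simp add: topspace_good)
  have "Inl [] \<in> ?T closure_of (range Inr)"
    unfolding closure_good using good_meets_branches[OF K] by blast
  then show "\<not> closedin ?T (range Inr)"
    using closure_of_closedin by fastforce
next
  fix F :: "'a node set" and x
  assume F: "F \<subseteq> range Inr" and x: "x \<notin> range Inr" and Fx: "?T closure_of F - F = {x}"
  obtain s where s: "x = Inl s"
    using x by (metis rangeI sumE)
  have "\<exists>V. good K V \<and> Inl (s @ [k]) \<in> V \<and> V \<inter> F = {}" if "k \<in> K" for k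
  proof -
    \<comment> \<open>\<open>F\<close> contains only branches, and its only outer limit is
      \<open>s\<close>, so a successor of \<open>s\<close> is not in the closure.\<close>
    have "Inl (s @ [k]) \<notin> F" "Inl (s @ [k]) \<noteq> x"
      using F s by auto
    then have "Inl (s @ [k]) \<notin> ?T closure_of F"
      using Fx by blast
    then show ?thesis
      unfolding closure_good by blast
  qed
  then obtain V where V: "\<And>k. k \<in> K \<Longrightarrow> good K (V k) \<and> Inl (s @ [k]) \<in> V k \<and> V k \<inter> F = {}"
    by metis
  let ?W = "insert (Inl s) (\<Union>k\<in>K. V k \<inter> subtree (s @ [k]))"
  have "good K ?W"
    using V by (intro good_step) auto
  moreover have "?W \<inter> F = {}"
    using V F by auto
  moreover have "Inl s \<in> ?T closure_of F"
    using Fx s by blast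
  ultimately show False
    unfolding closure_good by blast
qed

section \<open>Cardinalities\<close>

text \<open>Row \<open>n\<close> of a subset of the plane stores entry \<open>n\<close>, shifted by
  one. The freed value 0 marks that the row exists, which tells an empty entry from a missing one
  and a list from a branch.\<close>

definition encode :: "nat set node \<Rightarrow> nat set" where
  "encode p = {prod_encode (n, m) | n m. case p of
     Inl s \<Rightarrow> n < length s \<and> m \<in> insert 0 (Suc ` (s ! n))
   | Inr f \<Rightarrow> m \<in> insert 0 (Suc ` f n)}"

lemma inj_encode: "inj encode"
proof (rule injI)
  fix p q assume "encode p = encode q"
  then have eq: "prod_encode (n, m) \<in> encode p \<longleftrightarrow> prod_encode (n, m) \<in> encode q" for n m
    by simp
  have nth: "A = B" if "\<And>m. m = 0 \<or> m \<in> Suc ` A \<longleftrightarrow> m = 0 \<or> m \<in> Suc ` B" for A B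
    using that[of "Suc _"] by (auto simp: image_iff)
  show "p = q"
  proof (cases p; cases q)
    fix s t assume p: "p = Inl s" and q: "q = Inl t"
    have iff: "n < length s \<and> (m = 0 \<or> m \<in> Suc ` (s ! n)) \<longleftrightarrow>
        n < length t \<and> (m = 0 \<or> m \<in> Suc ` (t ! n))" for n m
      using eq[of n m] by (simp add: encode_def p q)
    \<comment> \<open>Comparing only the row markers yields equal lengths.\<close>
    from iff[of _ 0] have len: "length s = length t"
      by (meson linorder_neq_iff less_irrefl)
    moreover have "s ! n = t ! n" if "n < length s" for n
      using iff[of n] that len by (intro nth) blast
    ultimately show "p = q"
      by (simp add: p q nth_equalityI)
  next
    fix s f assume "p = Inl s" "q = Inr f"
    \<comment> \<open>A branch has a marker in row \<open>length s\<close>, the list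
      \<open>s\<close> does not.\<close>
    with eq[of "length s" 0] show "p = q"
      by (simp add: encode_def)
  next
    fix s f assume "p = Inr f" "q = Inl s"
    with eq[of "length s" 0] show "p = q"
      by (simp add: encode_def)
  next
    fix f g assume p: "p = Inr f" and q: "q = Inr g"
    have "f n = g n" for n
      using eq[of n] by (intro nth) (simp add: encode_def p q)
    then show "p = q"
      by (auto simp: p q)
  qed
qed

section \<open>Sizes of the alphabets and of the sets of finite sequences\<close>

lemma card_of_UNIV_nat_set: "|UNIV :: nat set set| =o continuum"
  using card_of_Pow_Func[of "UNIV :: nat set"]
  by (simp add: cexp_def ctwo_def Field_card_of Field_natLeq)

text \<open>Each level of the tree is an image of \<open>K\<close> times the previous one, so it has
  size at most that of \<open>K\<close>; there are countably many levels.\<close>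

lemma card_of_lists_infinite:
  assumes "infinite K"
  shows "|lists K| =o |K|"
proof -
  let ?L = "\<lambda>n. {s \<in> lists K. length s = n}"
  have L: "|?L n| \<le>o |K|" for n
  proof (induction n)
    case 0
    have "?L 0 = {[]}"
      by auto
    then show ?case
      using assms by (simp add: card_of_singl_ordLeq infinite_imp_nonempty)
  next
    case (Suc n)
    have "?L (Suc n) = (\<lambda>(k, s). k # s) ` (K \<times> ?L n)"
      by (auto simp: length_Suc_conv image_iff)
    then have "|?L (Suc n)| \<le>o |K \<times> ?L n|"
      by (simp only: card_of_image)
    also have "|K \<times> ?L n| \<le>o |K|"
      using assms Suc
      by (intro card_of_Times_ordLeq_infinite_Field) (simp_all add: Field_card_of card_of_card_order_on card_of_mono1)
    finally show ?case .
  qed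
  have "lists K = (\<Union>n. ?L n)"
    by auto
  also have "|\<Union>n. ?L n| \<le>o |K|"
    using assms L by (intro card_of_UNION_ordLeq_infinite) (auto simp: infinite_iff_card_of_nat[symmetric])
  finally have "|lists K| \<le>o |K|" .
  moreover have "|K| \<le>o |lists K|"
    by (rule card_of_ordLeqI[of "\<lambda>k. [k]"]) (auto simp: inj_on_def)
  ultimately show ?thesis
    by (simp add: ordIso_iff_ordLeq)
qed

lemma card_of_Field_omega1: "|Field omega1| =o omega1"
  by (simp add: card_of_Field_ordIso cardSuc_Card_order natLeq_Card_order)

lemma uncountable_Field_omega1: "uncountable (Field omega1)"
proof
  assume "countable (Field omega1)"
  then have "|Field omega1| \<le>o natLeq"
    by (simp add: countable_card_le_natLeq)
  then have "omega1 \<le>o natLeq"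
    using card_of_Field_omega1 ordIso_symmetric ordIso_ordLeq_trans by blast
  then show False
    using cardSuc_greater[OF natLeq_Card_order] not_ordLess_ordLeq by blast
qed

text \<open>\<open>omega1\<close> is a relation on \<open>nat set\<close>, so its uncountable field
  sits inside this type.\<close>

lemma uncountable_UNIV_nat_set: "uncountable (UNIV :: nat set set)"
  using uncountable_Field_omega1 countable_subset[OF subset_UNIV] by metis

section \<open>A weak P-space of size \<open>\<omega>\<^sub>1\<close>\<close>

text \<open>The initial base consists of the traces of good sets on the finite sequences. A basic
  set contains a successor of each of its points, and each such step flips the parity of the
  length.\<close>

lemma ex_weak_P_space_on_lists:
  assumes K: "uncountable K"
  obtains Y where "topspace Y = Inl ` lists K" "Hausdorff_space Y" "weak_P_space Y"
    "\<not> weakly_Whyburn (Y :: 'k node topology)"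
proof -
  define X :: "'k node set" where "X = Inl ` lists K"
  define A :: "'k node set" where "A = {Inl s | s. s \<in> lists K \<and> even (length s)}"
  define \<B>\<^sub>0 where "\<B>\<^sub>0 = (\<lambda>V. V \<inter> X) ` Collect (good K)"
  have succ: "\<exists>k\<in>K. Inl (s @ [k]) \<in> B" if B: "B \<in> \<B>\<^sub>0" and s: "Inl s \<in> B" for B s
  proof -
    obtain V where V: "good K V" "B = V \<inter> X"
      using B by (auto simp: \<B>\<^sub>0_def)
    obtain k where "k \<in> K" "Inl (s @ [k]) \<in> V"
      using good_successor[OF K V(1)] s V(2) by blast
    with s V show ?thesis
      by (auto simp: X_def image_iff)
  qed
  have BX: "\<B>\<^sub>0 \<subseteq> Pow X"
    by (auto simp: \<B>\<^sub>0_def)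
  have mem: "\<exists>s\<in>lists K. p = Inl s" if "B \<in> \<B>\<^sub>0" "p \<in> B" for B p
    using subsetD[OF BX that(1)] that(2) by (auto simp: X_def)
  have XB: "X \<in> \<B>\<^sub>0"
    using good_UNIV by (auto simp: \<B>\<^sub>0_def)
  \<comment> \<open>A sequence with one entry has odd length, so \<open>A\<close> is a proper
    subset.\<close>
  obtain k where "k \<in> K"
    using K by fastforce
  then have AX: "A \<subseteq> X" "A \<noteq> X"
    by (auto simp: A_def X_def set_eq_iff intro!: exI[of _ "Inl [k]"])
  have int: "B \<inter> C \<in> \<B>\<^sub>0" if BC: "B \<in> \<B>\<^sub>0" "C \<in> \<B>\<^sub>0" for B C
  proof -
    obtain U V where "good K U" "B = U \<inter> X" "good K V" "C = V \<inter> X"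
      using BC by (auto simp: \<B>\<^sub>0_def)
    then have "good K (U \<inter> V)" "B \<inter> C = (U \<inter> V) \<inter> X"
      by (auto intro: good_Int)
    then show ?thesis
      by (auto simp: \<B>\<^sub>0_def)
  qed
  have dense: "B \<inter> A \<noteq> {}" if B: "B \<in> \<B>\<^sub>0" and ne: "B \<noteq> {}" for B
  proof -
    obtain s where s: "Inl s \<in> B" "s \<in> lists K"
      using ne mem[OF B] by blast
    obtain k where "k \<in> K" "Inl (s @ [k]) \<in> B"
      using succ[OF B s(1)] by blast
    with s have "Inl s \<in> B \<inter> A \<or> Inl (s @ [k]) \<in> B \<inter> A"
      by (auto simp: A_def)
    then show ?thesis
      by blast
  qed
  have crowded: "B - A \<noteq> {y}" if B: "B \<in> \<B>\<^sub>0" for B y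
  proof
    assume y: "B - A = {y}"
    then obtain s where s: "y = Inl s" "s \<in> lists K"
      using mem[OF B] by blast
    then have "Inl s \<in> B" "odd (length s)"
      using y by (auto simp: A_def)
    \<comment> \<open>Two steps up the length is odd again, which gives a second point outside
      \<open>A\<close>.\<close>
    then obtain k l where "Inl (s @ [k]) \<in> B" "Inl ((s @ [k]) @ [l]) \<in> B"
      using succ[OF B] by metis
    with \<open>odd (length s)\<close> have "Inl (s @ [k, l]) \<in> B - A"
      by (auto simp: A_def)
    then show False
      using y s by simp
  qed
  obtain \<B> where \<B>: "\<B>\<^sub>0 \<subseteq> \<B>" "\<B> \<subseteq> Pow X" and Bint: "\<forall>B\<in>\<B>. \<forall>C\<in>\<B>. B \<inter> C \<in> \<B>"
    and W: "\<not> weakly_Whyburn (base_topology \<B>)"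
    using maximal_base_not_weakly_Whyburn[OF BX XB AX int dense crowded] by blast
  have top: "topspace (base_topology \<B>) = X"
    using \<B> XB topspace_base_topology[OF Bint] by blast
  \<comment> \<open>Traces of good sets stay open in the refinement, which is all that the two
    remaining properties require.\<close>
  have op: "openin (base_topology \<B>) (V \<inter> X)" if "good K V" for V
    by (rule openin_base_topology_base[OF Bint]) (use that \<B>(1) in \<open>auto simp: \<B>\<^sub>0_def\<close>)
  have "Hausdorff_space (base_topology \<B>)"
    unfolding Hausdorff_space_def top
  proof (intro allI impI, elim conjE)
    fix x y assume xy: "x \<in> X" "y \<in> X" "x \<noteq> y"
    then obtain U V where "good K U" "good K V" "x \<in> U" "y \<in> V" "U \<inter> V = {}"
      using good_separate by metis
    with xy show "\<exists>U V. openin (base_topology \<B>) U \<and> openin (base_topology \<B>) V \<and>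
        x \<in> U \<and> y \<in> V \<and> disjnt U V"
      by (intro exI[of _ "U \<inter> X"] exI[of _ "V \<inter> X"]) (auto simp: op disjnt_def)
  qed
  moreover have "weak_P_space (base_topology \<B>)"
    unfolding weak_P_space_def top
  proof (intro allI impI, elim conjE)
    fix S assume S: "S \<subseteq> X" "countable S"
    \<comment> \<open>Only countably many successors can fall into \<open>S\<close>, and
      \<open>S\<close> contains no branch, so the branch clause is automatic.\<close>
    have "good K (- S)"
      unfolding good_def
    proof (intro conjI allI impI)
      fix s
      let ?E = "{k \<in> K. Inl (s @ [k]) \<notin> - S}"
      have "countable ((\<lambda>k. Inl (s @ [k]) :: 'k node) ` ?E)"
        using S(2) by (rule countable_subset[rotated]) auto
      then show "countable ?E"
        by (rule countable_image_inj_on) (auto simp: inj_on_def)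
    qed (use S(1) in \<open>auto simp: X_def\<close>)
    from op[OF this] show "closedin (base_topology \<B>) S"
      using S(1) by (simp add: closedin_def top Diff_eq Int_commute)
  qed
  ultimately show thesis
    using that top W by (simp add: X_def)
qed

section \<open>Transfer of both spaces to sets of naturals\<close>

theorem mainTheorem2:
  shows "(\<exists>X :: nat set topology.
            Hausdorff_space X \<and> P_space X \<and> |topspace X| =o continuum \<and> \<not> weakly_Whyburn X) \<and>
         (\<exists>Y :: nat set topology.
            Hausdorff_space Y \<and> weak_P_space Y \<and> |topspace Y| =o omega1 \<and> \<not> weakly_Whyburn Y)"
proof
  let ?T = "base_topology (Collect (good (UNIV :: nat set set)))"
  obtain X where X: "topspace X = encode ` topspace ?T" and h: "homeomorphic_map ?T X encode"
    using homeomorphic_copy[OF inj_on_subset[OF inj_encode subset_UNIV]] by blast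
  \<comment> \<open>The copy consists of sets of naturals, which bounds its size from above; the
    codes of sequences with one entry bound it from below.\<close>
  have "|topspace X| \<le>o |UNIV :: nat set set|"
    by (simp add: card_of_mono1)
  moreover have "|UNIV :: nat set set| \<le>o |topspace X|"
    by (rule card_of_ordLeqI[of "\<lambda>a. encode (Inl [a])"])
       (auto simp: X topspace_good inj_on_def dest: injD[OF inj_encode])
  ultimately have "|topspace X| =o continuum"
    using card_of_UNIV_nat_set ordIso_iff_ordLeq ordIso_transitive by blast
  moreover have "Hausdorff_space X"
    using Hausdorff_good homeomorphic_Hausdorff_space homeomorphic_map_imp_homeomorphic_space[OF h]
    by blast
  moreover have "\<not> weakly_Whyburn X"
    using homeomorphic_map_weakly_Whyburn[OF h] not_weakly_Whyburn_good uncountable_UNIV_nat_set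
    by blast
  ultimately show "\<exists>X :: nat set topology.
      Hausdorff_space X \<and> P_space X \<and> |topspace X| =o continuum \<and> \<not> weakly_Whyburn X"
    using homeomorphic_map_P_space[OF h P_space_good] by blast
next
  obtain T where T: "topspace T = Inl ` lists (Field omega1)" "Hausdorff_space T" "weak_P_space T"
    "\<not> weakly_Whyburn (T :: nat set node topology)"
    using ex_weak_P_space_on_lists[OF uncountable_Field_omega1] by blast
  obtain Y where Y: "topspace Y = encode ` topspace T" and h: "homeomorphic_map T Y encode"
    using homeomorphic_copy[OF inj_on_subset[OF inj_encode subset_UNIV]] by blast
  have "bij_betw (\<lambda>s. encode (Inl s)) (lists (Field omega1)) (topspace Y)"
    by (auto simp: bij_betw_def inj_on_def Y T(1) image_image dest: injD[OF inj_encode])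
  then have "|topspace Y| =o |lists (Field omega1)|"
    using card_of_ordIsoI ordIso_symmetric by blast
  also have "|lists (Field omega1)| =o |Field omega1|"
    using card_of_lists_infinite uncountable_Field_omega1 countable_finite by blast
  also note card_of_Field_omega1
  finally have "|topspace Y| =o omega1" .
  moreover have "Hausdorff_space Y"
    using T(2) homeomorphic_Hausdorff_space homeomorphic_map_imp_homeomorphic_space[OF h] by blast
  ultimately show "\<exists>Y :: nat set topology.
      Hausdorff_space Y \<and> weak_P_space Y \<and> |topspace Y| =o omega1 \<and> \<not> weakly_Whyburn Y"
    using homeomorphic_map_weak_P_space[OF h T(3)] homeomorphic_map_weakly_Whyburn[OF h] T(4)
    by blast
qed

end
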